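(* Let $f_{n,k}=|\Pi_{n,k}/\sim_{ne}|$ for $n\ge k\ge1$. Then $f_{n,1}=1$, and for $k\ge2$, $$f_{n,k}=\sum_{r=k-1}^{n-1}f_{r,k-1}+(k-1)\binom{n-2}{k}.$$
   Context: $\Pi_{n,k}$ is the set of partitions of $[n]$ with $k$ blocks. Partitions are drawn with arcs joining consecutive elements of each block; $ne(\mu)$ is the number of pairs of arcs $(i_1,j_1),(i_2,j_2)$ with $i_1<i_2<j_2<j_1$. The tree of partitions has root the empty partition, and a partition $\mu$ of $[N+1]$ is a child of a partition $\nu$ of $[N]$ iff the restriction of $\mu$ to $\{2,\dots,N+1\}$ is order-isomorphic to $\nu$; $\mathcal{T}(\lambda,l,m)$ is the set of descendants of $\lambda$ at distance $l$ (partitions of $[n+l]$ whose restriction to the last $n$ elements is order-isomorphic to $\lambda\in\Pi_n$) having $m$ blocks. For $\lambda,\pi\in\Pi_n$, $\lambda\sim_{ne}\pi$ iff the multisets $\{ne(\mu):\mu\in\mathcal{T}(\lambda,l,m)\}$ and $\{ne(\mu):\mu\in\mathcal{T}(\pi,l,m)\}$ coincide for all $l,m\ge0$. $\Pi_{n,k}/\sim_{ne}$ is the set of equivalence classes of $\sim_{ne}$ restricted to $\Pi_{n,k}$. *)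

theory Defs
  imports Complex_Main "HOL-Library.Disjoint_Sets" "HOL-Library.Multiset"
begin

definition set_partitions :: "nat \<Rightarrow> nat set set set" where
  "set_partitions n = {P. partition_on {1..n} P}"

definition set_partitions_blocks :: "nat \<Rightarrow> nat \<Rightarrow> nat set set set" where
  "set_partitions_blocks n k = {P \<in> set_partitions n. card P = k}"

definition arcs :: "nat set set \<Rightarrow> (nat \<times> nat) set" where
  "arcs P = {(i, j). \<exists>B\<in>P. i \<in> B \<and> j \<in> B \<and> i < j \<and> (\<forall>x\<in>B. \<not> (i < x \<and> x < j))}"

definition ne :: "nat set set \<Rightarrow> nat" where
  "ne P = card {((i1, j1), (i2, j2)). (i1, j1) \<in> arcs P \<and> (i2, j2) \<in> arcs P \<and>
                   i1 < i2 \<and> i2 < j2 \<and> j2 < j1}"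

definition restrict_partition :: "'a set \<Rightarrow> 'a set set \<Rightarrow> 'a set set" where
  "restrict_partition A P = (\<inter>) A ` P - {{}}"

definition order_isomorphic :: "'a::linorder set set \<Rightarrow> 'b::linorder set set \<Rightarrow> bool" where
  "order_isomorphic P Q \<longleftrightarrow>
     (\<exists>f. bij_betw f (\<Union>P) (\<Union>Q) \<and> strict_mono_on (\<Union>P) f \<and> (`) f ` P = Q)"

definition child :: "nat set set \<Rightarrow> nat set set \<Rightarrow> bool" where
  "child \<nu> \<mu> \<longleftrightarrow> (\<exists>N. \<nu> \<in> set_partitions N \<and> \<mu> \<in> set_partitions (N + 1) \<and>
                  order_isomorphic (restrict_partition {2..N + 1} \<mu>) \<nu>)"

definition descendants :: "nat set set \<Rightarrow> nat \<Rightarrow> nat set set set" where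
  "descendants \<sigma> l = {\<mu>. (child ^^ l) \<sigma> \<mu>}"

definition tree_level :: "nat set set \<Rightarrow> nat \<Rightarrow> nat \<Rightarrow> nat set set set" where
  "tree_level \<sigma> l m = {\<mu> \<in> descendants \<sigma> l. card \<mu> = m}"

text \<open>The set under \<^const>\<open>mset_set\<close> is finite for every partition of $[n]$, see
  \<open>finite_tree_level\<close> below.\<close>

definition ne_sim :: "nat set set \<Rightarrow> nat set set \<Rightarrow> bool" where
  "ne_sim \<sigma> \<pi> \<longleftrightarrow> (\<forall>l m. image_mset ne (mset_set (tree_level \<sigma> l m)) =
                         image_mset ne (mset_set (tree_level \<pi> l m)))"

definition ne_rel :: "nat \<Rightarrow> nat \<Rightarrow> (nat set set \<times> nat set set) set" where
  "ne_rel n k = {(\<sigma>, \<pi>). \<sigma> \<in> set_partitions_blocks n k \<and> \<pi> \<in> set_partitions_blocks n k \<and>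
                         ne_sim \<sigma> \<pi>}"

definition ne_class_count :: "nat \<Rightarrow> nat \<Rightarrow> nat" where
  "ne_class_count n k = card (set_partitions_blocks n k // ne_rel n k)"

lemma equiv_ne_rel: "equiv (set_partitions_blocks n k) (ne_rel n k)"
  by (rule equivI) (auto simp: ne_rel_def ne_sim_def refl_on_def sym_def trans_def)

lemma strict_mono_interval_shift:
  fixes f :: "nat \<Rightarrow> nat"
  assumes "bij_betw f {l + 1..l + n} {1..n}" "strict_mono_on {l + 1..l + n} f"
    and "i \<in> {l + 1..l + n}"
  shows "f i = i - l"
proof -
  have lo: "i \<le> l + n \<Longrightarrow> f i \<ge> i - l" if "i \<ge> l + 1" for i
    using that
  proof (induction i rule: nat_induct_at_least)
    case base
    then show ?case using bij_betwE[OF assms(1)] by fastforce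
  next
    case (Suc i)
    have "f i < f (Suc i)"
      using strict_mono_onD[OF assms(2), of i "Suc i"] Suc by auto
    then show ?case using Suc by linarith
  qed
  have hi: "f (l + n - d) \<le> n - d" if "d < n" for d
    using that
  proof (induction d)
    case 0
    then show ?case using bij_betwE[OF assms(1)] by force
  next
    case (Suc d)
    have "f (l + n - Suc d) < f (l + n - d)"
      using strict_mono_onD[OF assms(2), of "l + n - Suc d" "l + n - d"] Suc.prems by auto
    then show ?case using Suc by linarith
  qed
  show ?thesis using lo[of i] hi[of "l + n - i"] assms(3) by auto
qed

lemma Union_restrict_partition: "\<Union>(restrict_partition A P) = A \<inter> \<Union>P"
  by (auto simp: restrict_partition_def)

lemma order_isomorphic_shift_iff:
  assumes "\<mu> \<in> set_partitions (l + n)" "\<sigma> \<in> set_partitions n"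
  shows "order_isomorphic (restrict_partition {l + 1..l + n} \<mu>) \<sigma> \<longleftrightarrow>
         (`) (\<lambda>i. i - l) ` restrict_partition {l + 1..l + n} \<mu> = \<sigma>"
    (is "?iso \<longleftrightarrow> (`) ?s ` ?R = \<sigma>")
proof -
  have U: "\<Union>?R = {l + 1..l + n}"
    using assms(1) unfolding Union_restrict_partition
    by (auto simp: set_partitions_def dest!: partition_onD1)
  have V: "\<Union>\<sigma> = {1..n}"
    using assms(2) by (auto simp: set_partitions_def dest!: partition_onD1)
  show ?thesis
  proof
    assume ?iso
    then obtain f where f: "bij_betw f {l + 1..l + n} {1..n}" "strict_mono_on {l + 1..l + n} f"
        "(`) f ` ?R = \<sigma>"
      unfolding order_isomorphic_def U V by blast
    have "f ` B = ?s ` B" if "B \<in> ?R" for B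
      using that U strict_mono_interval_shift[OF f(1,2)] by (intro image_cong) blast+
    then show "(`) ?s ` ?R = \<sigma>" using f(3) by (metis (no_types, lifting) image_cong)
  next
    assume "(`) ?s ` ?R = \<sigma>"
    moreover have "bij_betw ?s {l + 1..l + n} {1..n}"
      by (rule bij_betw_byWitness[where f' = "\<lambda>i. i + l"]) auto
    moreover have "strict_mono_on {l + 1..l + n} ?s"
      by (auto intro!: strict_mono_onI)
    ultimately show ?iso unfolding order_isomorphic_def U V by blast
  qed
qed

lemma shift_restrict_in_set_partitions:
  assumes "\<mu> \<in> set_partitions (l + n)"
  shows "(`) (\<lambda>i. i - l) ` restrict_partition {l + 1..l + n} \<mu> \<in> set_partitions n"
proof -
  let ?s = "\<lambda>i::nat. i - l"
  have P: "partition_on {l + 1..l + n} (restrict_partition {l + 1..l + n} \<mu>)"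
    using partition_on_restrict[of "{1..l + n}" \<mu> "{l + 1..l + n}"] assms
    by (simp add: set_partitions_def restrict_partition_def Int_absorb2)
  have "inj_on ?s {l + 1..l + n}" by (auto simp: inj_on_def)
  from partition_on_inj_image[OF P this]
  have "partition_on (?s ` {l + 1..l + n})
          ((`) ?s ` restrict_partition {l + 1..l + n} \<mu> - {{}})" .
  moreover have "?s ` {l + 1..l + n} = {1..n}"
    by (auto simp: image_iff intro!: bexI[of _ "_ + l"])
  moreover have "{} \<notin> (`) ?s ` restrict_partition {l + 1..l + n} \<mu>"
    by (auto simp: restrict_partition_def)
  ultimately show ?thesis by (simp add: set_partitions_def)
qed

lemma shift_restrict_shift_restrict:
  "(`) (\<lambda>i. i - l) ` restrict_partition {l + 1..l + n}
     ((`) (\<lambda>i. i - 1) ` restrict_partition {2..l + n + 1} \<mu>) =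
   (`) (\<lambda>i. i - Suc l) ` restrict_partition {Suc l + 1..Suc l + n} \<mu>"
proof -
  have A: "(`) h ` restrict_partition A (X - {{}}) = (\<lambda>B. h ` (A \<inter> B)) ` X - {{}}"
    for h :: "nat \<Rightarrow> nat" and A X
    unfolding restrict_partition_def by auto
  have A': "(`) h ` restrict_partition A X = (\<lambda>B. h ` (A \<inter> B)) ` X - {{}}"
    for h :: "nat \<Rightarrow> nat" and A X
    unfolding restrict_partition_def by auto
  have *: "(\<lambda>i. i - l) ` ({l + 1..l + n} \<inter> (\<lambda>i. i - 1) ` ({2..l + n + 1} \<inter> B)) =
        (\<lambda>i. i - Suc l) ` ({Suc l + 1..Suc l + n} \<inter> B)" for B :: "nat set"
  proof -
    have "{l + 1..l + n} \<inter> (\<lambda>i. i - 1) ` ({2..l + n + 1} \<inter> B) =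
          (\<lambda>i. i - 1) ` ({Suc l + 1..Suc l + n} \<inter> B)"
      by (auto intro!: imageI)
    then show ?thesis by (simp add: image_image)
  qed
  show ?thesis
    unfolding A'[of "\<lambda>i. i - 1"] unfolding A image_image * unfolding A' ..
qed

lemma set_partitions_inject:
  "P \<in> set_partitions M \<Longrightarrow> P \<in> set_partitions N \<Longrightarrow> M = N"
  unfolding set_partitions_def mem_Collect_eq
  by (metis partition_onD1 card_atLeastAtMost diff_Suc_1)

lemma child_iff:
  assumes "\<nu> \<in> set_partitions N"
  shows "child \<nu> \<mu> \<longleftrightarrow> \<mu> \<in> set_partitions (N + 1) \<and>
           (`) (\<lambda>i. i - 1) ` restrict_partition {2..N + 1} \<mu> = \<nu>"
proof -
  have "child \<nu> \<mu> \<longleftrightarrow> \<mu> \<in> set_partitions (N + 1) \<and>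
          order_isomorphic (restrict_partition {2..N + 1} \<mu>) \<nu>"
    unfolding child_def using assms set_partitions_inject by blast
  also have "\<dots> \<longleftrightarrow> \<mu> \<in> set_partitions (N + 1) \<and>
           (`) (\<lambda>i. i - 1) ` restrict_partition {2..N + 1} \<mu> = \<nu>"
    using order_isomorphic_shift_iff[of \<mu> 1 N \<nu>] assms by (auto simp: numeral_2_eq_2)
  finally show ?thesis .
qed

lemma descendants_eq:
  assumes "\<sigma> \<in> set_partitions n"
  shows "descendants \<sigma> l = {\<mu> \<in> set_partitions (l + n).
           order_isomorphic (restrict_partition {l + 1..l + n} \<mu>) \<sigma>}"
proof -
  have "(child ^^ l) \<sigma> \<mu> \<longleftrightarrow> \<mu> \<in> set_partitions (l + n) \<and>
          (`) (\<lambda>i. i - l) ` restrict_partition {l + 1..l + n} \<mu> = \<sigma>" for \<mu>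
  proof (induction l arbitrary: \<mu>)
    case 0
    have "restrict_partition {1..n} \<mu> = \<mu>" if "\<mu> \<in> set_partitions n" for \<mu>
    proof -
      have "{1..n} \<inter> B = B" if "B \<in> \<mu>" for B
        using that \<open>\<mu> \<in> set_partitions n\<close>
        by (auto simp: set_partitions_def dest!: partition_onD1)
      moreover have "{} \<notin> \<mu>" using that by (auto simp: set_partitions_def partition_on_def)
      ultimately show ?thesis by (auto simp: restrict_partition_def image_iff)
    qed
    then show ?case using assms by auto
  next
    case (Suc l)
    let ?\<nu> = "(`) (\<lambda>i. i - 1) ` restrict_partition {2..l + n + 1} \<mu>"
    have "(child ^^ Suc l) \<sigma> \<mu> \<longleftrightarrow> (\<exists>\<nu>. (child ^^ l) \<sigma> \<nu> \<and> child \<nu> \<mu>)"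
      by auto
    also have "\<dots> \<longleftrightarrow> (\<exists>\<nu>. \<nu> \<in> set_partitions (l + n) \<and>
        (`) (\<lambda>i. i - l) ` restrict_partition {l + 1..l + n} \<nu> = \<sigma> \<and>
        \<mu> \<in> set_partitions (l + n + 1) \<and> ?\<nu> = \<nu>)"
      unfolding Suc.IH using child_iff[of _ "l + n" \<mu>] by blast
    also have "\<dots> \<longleftrightarrow> \<mu> \<in> set_partitions (l + n + 1) \<and>
        (`) (\<lambda>i. i - l) ` restrict_partition {l + 1..l + n} ?\<nu> = \<sigma>"
      using shift_restrict_in_set_partitions[of \<mu> 1 "l + n"] by (auto simp: numeral_2_eq_2)
    finally show ?case unfolding shift_restrict_shift_restrict by simp
  qed
  then show ?thesis
    using assms order_isomorphic_shift_iff by (auto simp: descendants_def)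
qed

lemma finite_tree_level:
  assumes "\<sigma> \<in> set_partitions n"
  shows "finite (tree_level \<sigma> l m)"
proof (rule finite_subset)
  show "tree_level \<sigma> l m \<subseteq> {P. partition_on {1..l + n} P}"
    using assms by (auto simp: tree_level_def descendants_eq set_partitions_def)
qed (simp add: finitely_many_partition_on)

end

theory Submission
  imports Defs
begin

text \<open>
  Let $M$ be the set of block minima of a partition. A child is obtained either by adding a new
  singleton or by joining the new first element to a block with minimum $m$; in the second case
  the new arc covers exactly the arcs ending before $m$, and there are
  $|\{1,\dots,m-1\} - M|$ of these. So the nesting numbers of all descendants
  depend only on $M$ and \<open>ne\<close>; conversely, level 0 of the tree returns \<open>ne\<close> and level 1 returns the
  numbers $|\{1,\dots,m-1\} - M|$, which determine $M$. Hence the classes correspond to the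
  pairs ($M$, \<open>ne\<close>) that occur. For fixed $M$ of size $k$ the values of \<open>ne\<close> fill an interval
  starting at 0 and ending at the sum of $|M \cap \{2,\dots,p\}|$ over $p \le n - k$ (all
  nonmaximal elements being as small as possible). Summing over $M$ gives
  $f_{n,k} = {n-1 \choose k-1} + {k \choose 2}{n-2 \choose k}$, from which the recursion follows.
\<close>

subsection \<open>Adding a first element to a partition\<close>

definition block_mins :: "nat set set \<Rightarrow> nat set" where
  "block_mins P = Min ` P"

text \<open>The child in which 1 joins the block \<open>C\<close>; for \<open>C = {}\<close> it is a new singleton.\<close>

definition extend :: "nat set \<Rightarrow> nat set set \<Rightarrow> nat set set" where
  "extend C P = insert (insert 1 (Suc ` C)) ((`) Suc ` (P - {C}))"

lemma set_partitionsD: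
  assumes "P \<in> set_partitions n"
  shows "\<Union>P = {1..n}" "disjoint P" "{} \<notin> P" "finite P"
    "\<And>B. B \<in> P \<Longrightarrow> finite B \<and> B \<noteq> {} \<and> B \<subseteq> {1..n}"
proof -
  have p: "partition_on {1..n} P" using assms by (simp add: set_partitions_def)
  show U: "\<Union>P = {1..n}" and "disjoint P" and e: "{} \<notin> P"
    using p by (auto simp: partition_on_def)
  show "finite P" using U by (simp add: finite_UnionD)
  show "finite B \<and> B \<noteq> {} \<and> B \<subseteq> {1..n}" if "B \<in> P" for B
    using U e that by (metis Sup_upper finite_atLeastAtMost finite_subset)
qed

lemma same_block:
  assumes "P \<in> set_partitions n" "B \<in> P" "C \<in> P" "x \<in> B" "x \<in> C"
  shows "B = C"
proof (rule ccontr)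
  assume "B \<noteq> C"
  then have "B \<inter> C = {}" using set_partitionsD(2)[OF assms(1)] assms(2,3) by (rule disjointD[rotated -1])
  then show False using assms(4,5) by blast
qed

lemma inj_on_Min_blocks:
  assumes "P \<in> set_partitions n"
  shows "inj_on Min P"
proof (rule inj_onI)
  fix B C assume BC: "B \<in> P" "C \<in> P" "Min B = Min C"
  have "Min B \<in> B" "Min C \<in> C"
    using set_partitionsD(5)[OF assms] BC(1,2) by (auto intro!: Min_in)
  then show "B = C" using same_block[OF assms BC(1,2), of "Min B"] BC(3) by simp
qed

lemma card_block_mins: "P \<in> set_partitions n \<Longrightarrow> card (block_mins P) = card P"
  unfolding block_mins_def by (rule card_image[OF inj_on_Min_blocks])

lemma block_mins_subset:
  assumes "P \<in> set_partitions n"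
  shows "block_mins P \<subseteq> {1..n}"
proof
  fix m assume "m \<in> block_mins P"
  then obtain B where "B \<in> P" "m = Min B" unfolding block_mins_def by auto
  then show "m \<in> {1..n}" using set_partitionsD(5)[OF assms, of B] Min_in[of B] by blast
qed

lemma one_in_block_mins:
  assumes "P \<in> set_partitions n" "1 \<le> n"
  shows "1 \<in> block_mins P"
proof -
  have "1 \<in> \<Union>P" unfolding set_partitionsD(1)[OF assms(1)] using assms(2) by simp
  then obtain B where B: "B \<in> P" "1 \<in> B" by blast
  have "Min B = 1"
    using set_partitionsD(5)[OF assms(1) B(1)] B(2) by (intro Min_eqI) auto
  then show ?thesis using imageI[OF B(1), of Min] unfolding block_mins_def by simp
qed

lemma set_partitions_0: "set_partitions 0 = {{}}"
  by (auto simp: set_partitions_def partition_on_empty)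

lemma empty_or_block:
  assumes "P \<in> set_partitions n" "C \<in> insert {} P"
  shows "finite C" "C \<subseteq> {1..n}" "0 \<notin> C"
proof -
  show "finite C" "C \<subseteq> {1..n}" using set_partitionsD(5)[OF assms(1), of C] assms(2) by auto
  then show "0 \<notin> C" by auto
qed

lemma extend_in_set_partitions:
  assumes P: "P \<in> set_partitions n" and C: "C \<in> insert {} P"
  shows "extend C P \<in> set_partitions (n + 1)"
proof -
  note C' = empty_or_block[OF P C]
  have CU: "\<Union>(P - {C}) \<union> C = {1..n}" using set_partitionsD(1)[OF P] C by auto
  have "\<Union>(extend C P) = insert 1 (Suc ` (\<Union>(P - {C}) \<union> C))"
    unfolding extend_def by auto
  also have "\<dots> = {1..n + 1}" unfolding CU image_Suc_atLeastAtMost by auto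
  finally have U: "\<Union>(extend C P) = {1..n + 1}" .
  have new: "insert 1 (Suc ` C) \<inter> Suc ` B = {}" if "B \<in> P - {C}" for B
  proof -
    have "0 \<notin> B" using set_partitionsD(5)[OF P, of B] that by auto
    moreover have "B \<inter> C = {}" using that C same_block[OF P] by fastforce
    ultimately show ?thesis by auto
  qed
  have old: "Suc ` A \<inter> Suc ` B = {}" if "A \<in> P - {C}" "B \<in> P - {C}" "A \<noteq> B" for A B
  proof -
    have "A \<inter> B = {}" using that same_block[OF P] by fastforce
    then show ?thesis by auto
  qed
  have "disjoint (extend C P)"
  proof (rule disjointI)
    fix A B assume AB: "A \<in> extend C P" "B \<in> extend C P" "A \<noteq> B"
    have cases: "X = insert 1 (Suc ` C) \<or> (\<exists>Y\<in>P - {C}. X = Suc ` Y)" if "X \<in> extend C P" for X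
      using that unfolding extend_def by (simp add: image_iff)
    from cases[OF AB(1)] show "A \<inter> B = {}"
    proof (elim disjE bexE)
      assume A: "A = insert 1 (Suc ` C)"
      then obtain Y where "Y \<in> P - {C}" "B = Suc ` Y" using cases[OF AB(2)] AB(3) by metis
      then show ?thesis using new A by simp
    next
      fix X assume X: "X \<in> P - {C}" "A = Suc ` X"
      from cases[OF AB(2)] show ?thesis
      proof (elim disjE bexE)
        assume "B = insert 1 (Suc ` C)"
        then show ?thesis using new[OF X(1)] X(2) by (simp add: Int_commute)
      next
        fix Y assume Y: "Y \<in> P - {C}" "B = Suc ` Y"
        have "X \<noteq> Y" using X Y AB(3) by auto
        then show ?thesis using old[OF X(1) Y(1)] X(2) Y(2) by simp
      qed
    qed
  qed
  moreover have "{} \<notin> extend C P"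
    using set_partitionsD(3)[OF P] unfolding extend_def by auto
  ultimately show ?thesis using U by (simp add: set_partitions_def partition_on_def)
qed

lemma extend_inject:
  assumes P: "P \<in> set_partitions n"
  shows "inj_on (\<lambda>C. extend C P) (insert {} P)"
proof (rule inj_onI)
  fix C D assume CD: "C \<in> insert {} P" "D \<in> insert {} P" "extend C P = extend D P"
  have new: "insert 1 (Suc ` X) \<in> extend X P" for X unfolding extend_def by simp
  have mem: "insert 1 (Suc ` C) \<in> extend C P" "insert 1 (Suc ` D) \<in> extend C P"
    using new[of C] new[of D] unfolding CD(3) by simp_all
  have eq: "insert 1 (Suc ` C) = insert 1 (Suc ` D)"
    by (rule same_block[OF extend_in_set_partitions[OF P CD(1)] mem, of 1]) auto
  have "Suc ` C = insert 1 (Suc ` C) - {1}"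
    using empty_or_block(3)[OF P CD(1)] by auto
  also have "\<dots> = insert 1 (Suc ` D) - {1}" unfolding eq ..
  also have "\<dots> = Suc ` D"
    using empty_or_block(3)[OF P CD(2)] by auto
  finally show "C = D" by (simp add: inj_image_eq_iff)
qed

lemma parent_extend:
  assumes P: "P \<in> set_partitions n" and C: "C \<in> insert {} P"
  shows "(`) (\<lambda>i. i - 1) ` restrict_partition {2..n + 1} (extend C P) = P"
proof -
  note C' = empty_or_block[OF P C]
  have 1: "{2..n + 1} \<inter> insert 1 (Suc ` C) = Suc ` C" using C' by auto
  have 2: "{2..n + 1} \<inter> Suc ` B = Suc ` B" if "B \<in> P" for B
    using set_partitionsD(5)[OF P that] by auto
  have "(\<inter>) {2..n + 1} ` extend C P = insert (Suc ` C) ((`) Suc ` (P - {C}))"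
    unfolding extend_def image_insert 1 using 2 by (simp add: image_image cong: image_cong_simp)
  also have "\<dots> = (`) Suc ` insert C P" by auto
  finally have "restrict_partition {2..n + 1} (extend C P) = (`) Suc ` P"
    unfolding restrict_partition_def using set_partitionsD(3)[OF P] C by auto
  then show ?thesis by (simp add: image_image)
qed

lemma extend_parent:
  assumes Q: "Q \<in> set_partitions (n + 1)" 
    and P: "P = (`) (\<lambda>i. i - 1) ` restrict_partition {2..n + 1} Q"
  shows "\<exists>C\<in>insert {} P. Q = extend C P"
proof -
  have "1 \<in> \<Union>Q" unfolding set_partitionsD(1)[OF Q] by simp
  then obtain B1 where B1: "B1 \<in> Q" "1 \<in> B1" by blast
  define pr where "pr = (\<lambda>i::nat. i - 1)"
  \<comment> \<open>The block of 1 without 1, shifted down; it is empty exactly when 1 is a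
    singleton of \<open>Q\<close>.\<close>
  define C where "C = pr ` (B1 - {1})"
  have ge: "B \<subseteq> {1..n+1}" if "B \<in> Q" for B using set_partitionsD(5)[OF Q that] by blast
  have Suc_pr: "Suc ` pr ` B = B" if "B \<subseteq> {1..n + 1}" for B
  proof -
    have "Suc ` pr ` B = id ` B"
      unfolding image_image pr_def using that by (intro image_cong) auto
    then show ?thesis by simp
  qed
  have SC: "Suc ` C = B1 - {1}"
    unfolding C_def using ge[OF B1(1)] by (intro Suc_pr) blast
  have int: "{2..n + 1} \<inter> B1 = B1 - {1}" using ge[OF B1(1)] by auto
  have no1: "1 \<notin> B" if "B \<in> Q - {B1}" for B using that B1 same_block[OF Q] by blast
  have int': "{2..n + 1} \<inter> B = B" if "B \<in> Q - {B1}" for B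
  proof -
    have "B \<subseteq> {1..n + 1} - {1}" using ge[of B] no1[OF that] that by blast
    also have "\<dots> = {2..n + 1}" by auto
    finally show ?thesis by blast
  qed
  have Spr: "Suc ` pr ` B = B" if "B \<in> Q - {B1}" for B
    using ge[of B] that by (intro Suc_pr) blast
  have "(\<inter>) {2..n + 1} ` Q = insert (B1 - {1}) ((\<inter>) {2..n + 1} ` (Q - {B1}))"
    using B1(1) int by auto
  also have "(\<inter>) {2..n + 1} ` (Q - {B1}) = Q - {B1}" using int' by (auto simp: image_iff)
  finally have R: "restrict_partition {2..n + 1} Q = insert (B1 - {1}) (Q - {B1}) - {{}}"
    by (simp add: restrict_partition_def)
  have Pe: "P = insert C ((`) pr ` (Q - {B1})) - {{}}"
    unfolding P R C_def pr_def[symmetric] using set_partitionsD(3)[OF Q] by auto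
  have Cin: "C \<in> insert {} P" using Pe by auto
  have neq: "pr ` B \<noteq> C" if "B \<in> Q - {B1}" for B
  proof
    assume "pr ` B = C"
    then have "B = B1 - {1}" using Spr[OF that] SC by simp
    moreover have "B \<noteq> {}" using that set_partitionsD(3)[OF Q] by auto
    ultimately show False using same_block[OF Q, of B B1] that B1 by blast
  qed
  have "P - {C} = (`) pr ` (Q - {B1})"
    unfolding Pe using neq set_partitionsD(3)[OF Q] by auto
  then have "(`) Suc ` (P - {C}) = (\<lambda>B. Suc ` pr ` B) ` (Q - {B1})" by (simp add: image_image)
  also have "\<dots> = Q - {B1}" using Spr by (auto simp: image_iff)
  finally have "extend C P = insert B1 (Q - {B1})"
    unfolding extend_def SC using B1(2) by (simp add: insert_absorb)
  then show ?thesis using Cin B1(1) by (metis insert_Diff)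
qed

lemma child_iff_extend:
  assumes "P \<in> set_partitions n"
  shows "child P Q \<longleftrightarrow> (\<exists>C\<in>insert {} P. Q = extend C P)"
  using child_iff[OF assms] extend_in_set_partitions[OF assms] parent_extend[OF assms]
    extend_parent[of Q n P] by metis

text \<open>The joined block gets minimum 1, so its old minimum disappears, while all other minima
  shift by one. Writing \<open>{C} - {{}}\<close> treats the new singleton uniformly and avoids
  \<open>Min {}\<close>.\<close>

lemma block_mins_extend:
  assumes P: "P \<in> set_partitions n" and C: "C \<in> insert {} P"
  shows "block_mins (extend C P) = insert 1 (Suc ` (block_mins P - Min ` ({C} - {{}})))"
proof -
  have "Min (insert 1 (Suc ` C)) = 1"
    using empty_or_block[OF P C] by (intro Min_eqI) auto
  moreover have "Min (Suc ` B) = Suc (Min B)" if "B \<in> P - {C}" for B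
    using set_partitionsD(5)[OF P, of B] that by (simp add: mono_Suc mono_Min_commute)
  ultimately have "block_mins (extend C P) = insert 1 (Suc ` Min ` (P - {C}))"
    unfolding block_mins_def extend_def image_insert by (simp add: image_image cong: image_cong_simp)
  also have "Min ` (P - {C}) = block_mins P - Min ` ({C} - {{}})"
    using inj_on_image_set_diff[OF inj_on_Min_blocks[OF P], of P "{C} - {{}}"]
      set_partitionsD(3)[OF P] C
    unfolding block_mins_def by (cases "C = {}") auto
  finally show ?thesis .
qed

section \<open>Arcs and nestings after adding a first element\<close>

lemma finite_arcs:
  assumes P: "P \<in> set_partitions n"
  shows "finite (arcs P)" "arcs P \<subseteq> {1..n} \<times> {1..n}"
proof -
  show "arcs P \<subseteq> {1..n} \<times> {1..n}"
    using set_partitionsD(5)[OF P] unfolding arcs_def by blast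
  then show "finite (arcs P)" by (rule finite_subset) simp
qed

text \<open>An arc is determined by its right end, and the right ends are exactly the elements that
  are not block minima.\<close>

lemma card_arcs_before:
  assumes P: "P \<in> set_partitions n" and "m \<le> n + 1"
  shows "card {a \<in> arcs P. snd a < m} = card ({1..<m} - block_mins P)"
proof (rule bij_betw_same_card[of snd])
  have "inj_on snd (arcs P)"
  proof (rule inj_onI)
    fix a b assume ab: "a \<in> arcs P" "b \<in> arcs P" "snd a = snd b"
    obtain i j where a: "a = (i, j)" by fastforce
    with ab obtain i' where b: "b = (i', j)" by (cases b) auto
    obtain B B' where B: "B \<in> P" "i \<in> B" "j \<in> B" "i < j" "\<forall>x\<in>B. \<not> (i < x \<and> x < j)"
      and B': "B' \<in> P" "i' \<in> B'" "j \<in> B'" "i' < j" "\<forall>x\<in>B'. \<not> (i' < x \<and> x < j)"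
      using ab a b unfolding arcs_def by auto
    have "B = B'" using same_block[OF P] B B' by blast
    then show "a = b" using B B' a b by (metis linorder_neqE_nat)
  qed
  then have inj: "inj_on snd {a \<in> arcs P. snd a < m}" by (rule inj_on_subset) auto
  have "snd ` {a \<in> arcs P. snd a < m} = {1..<m} - block_mins P"
  proof (intro equalityI subsetI)
    fix j assume "j \<in> snd ` {a \<in> arcs P. snd a < m}"
    then obtain i B where B: "B \<in> P" "i \<in> B" "j \<in> B" "i < j" "j < m" unfolding arcs_def by auto
    have "j \<notin> block_mins P"
    proof
      assume "j \<in> block_mins P"
      then obtain D where D: "D \<in> P" "j = Min D" unfolding block_mins_def by auto
      have "j \<in> D" using set_partitionsD(5)[OF P D(1)] D(2) Min_in by metis
      then have "D = B" using same_block[OF P] B D by blast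
      then show False using Min_le[of B i] B D set_partitionsD(5)[OF P D(1)] by auto
    qed
    then show "j \<in> {1..<m} - block_mins P" using B by auto
  next
    fix j assume j: "j \<in> {1..<m} - block_mins P"
    then have "j \<in> \<Union>P" unfolding set_partitionsD(1)[OF P] using assms(2) by auto
    then obtain B where B: "B \<in> P" "j \<in> B" by blast
    note fB = set_partitionsD(5)[OF P B(1)]
    have "Min B \<noteq> j" using j B unfolding block_mins_def by auto
    then have "Min B < j" using fB B(2) by (simp add: order_le_neq_trans)
    then have ne: "{x \<in> B. x < j} \<noteq> {}" using fB Min_in by blast
    \<comment> \<open>The predecessor of \<open>j\<close> in its block, hence the left end of the
      arc ending at \<open>j\<close>.\<close>
    define i where "i = Max {x \<in> B. x < j}"
    have i: "i \<in> B" "i < j" using Max_in[OF _ ne] fB unfolding i_def by auto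
    moreover have "\<not> (i < x \<and> x < j)" if "x \<in> B" for x
    proof
      assume x: "i < x \<and> x < j"
      then have "x \<le> i" unfolding i_def using fB that by (intro Max_ge) auto
      then show False using x by simp
    qed
    ultimately have "(i, j) \<in> arcs P" unfolding arcs_def using B by auto
    then show "j \<in> snd ` {a \<in> arcs P. snd a < m}" using j by force
  qed
  then show "bij_betw snd {a \<in> arcs P. snd a < m} ({1..<m} - block_mins P)"
    using inj by (simp add: bij_betw_def)
qed

text \<open>Old arcs are shifted. The only possible new arc starts at 1 and ends at the shifted
  minimum of \<open>C\<close>, since nothing of the joined block lies between; a new singleton
  contributes none.\<close>

lemma arcs_extend:
  assumes P: "P \<in> set_partitions n" and C: "C \<in> insert {} P"
  shows "arcs (extend C P) = map_prod Suc Suc ` arcs P \<union> (\<lambda>B. (1, Suc (Min B))) ` ({C} - {{}})"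
    (is "?L = ?R")
proof (intro equalityI subsetI)
  note C' = empty_or_block[OF P C]
  fix a assume "a \<in> ?L"
  then obtain i j B where a: "a = (i, j)" and B: "B \<in> extend C P" "i \<in> B" "j \<in> B" "i < j"
    and gap: "\<forall>x\<in>B. \<not> (i < x \<and> x < j)" unfolding arcs_def by auto
  show "a \<in> ?R"
  \<comment> \<open>Old and new arcs are told apart by the left end: a shifted old element, or else
    1.\<close>
  proof (cases "i \<in> Suc ` \<Union>P")
    case True
    then obtain i' where i': "i = Suc i'" "i' \<in> \<Union>P" by blast
    then have "i' \<ge> 1" unfolding set_partitionsD(1)[OF P] by simp
    obtain j' where j': "j = Suc j'" using B(4) by (cases j) auto
    have "B = insert 1 (Suc ` C) \<or> B \<in> (`) Suc ` (P - {C})"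
      using B(1) unfolding extend_def by simp
    then obtain D where D: "D \<in> P" "i' \<in> D" "j' \<in> D" "Suc ` D \<subseteq> B"
    proof
      assume "B = insert 1 (Suc ` C)"
      moreover from this have "i' \<in> C" "j' \<in> C" using B(2-4) i'(1) j' \<open>i' \<ge> 1\<close> by auto
      ultimately show ?thesis using that[of C] C by auto
    next
      assume "B \<in> (`) Suc ` (P - {C})"
      then show ?thesis using that B(2,3) i'(1) j' by auto
    qed
    have "\<not> (i' < x \<and> x < j')" if "x \<in> D" for x
    proof -
      have "Suc x \<in> B" using that D(4) by blast
      then show ?thesis using gap i'(1) j' by auto
    qed
    then have "(i', j') \<in> arcs P" using D(1-3) B(4) i'(1) j' unfolding arcs_def by auto
    then have "map_prod Suc Suc (i', j') \<in> map_prod Suc Suc ` arcs P" by (rule imageI)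
    then show ?thesis using a i'(1) j' by simp
  next
    case False
    have B1: "B = insert 1 (Suc ` C)"
    proof (rule ccontr)
      assume "B \<noteq> insert 1 (Suc ` C)"
      then have "B \<in> (`) Suc ` (P - {C})" using B(1) unfolding extend_def by simp
      then show False using B(2) False by blast
    qed
    have "C \<subseteq> \<Union>P" using C by blast
    then have i1: "i = 1" using False B(2) B1 by blast
    have "C \<noteq> {}" using B1 B i1 by auto
    have j: "j \<in> Suc ` C" using B B1 i1 by auto
    then have "Min C \<le> j - 1" using C'(1) by auto
    moreover have "\<not> Suc (Min C) < j"
    proof -
      have "Min C \<in> C" using \<open>C \<noteq> {}\<close> C'(1) by simp
      then have "Suc (Min C) \<in> B" "0 < Min C" using B1 C'(3) by (auto intro: gr0I)
      then show ?thesis using gap i1 by auto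
    qed
    ultimately have "j = Suc (Min C)" using j by auto
    then show ?thesis using a i1 \<open>C \<noteq> {}\<close> by auto
  qed
next
  note C' = empty_or_block[OF P C]
  fix a assume "a \<in> ?R"
  then consider i j where "a = (Suc i, Suc j)" "(i, j) \<in> arcs P" | "C \<noteq> {}" "a = (1, Suc (Min C))"
    by auto
  then show "a \<in> ?L"
  proof cases
    case 1
    then obtain B where B: "B \<in> P" "i \<in> B" "j \<in> B" "i < j" "\<forall>x\<in>B. \<not> (i < x \<and> x < j)"
      unfolding arcs_def by auto
    \<comment> \<open>The shifted block may have gained 1, which is too small to lie strictly
      between \<open>Suc i\<close> and \<open>Suc j\<close>.\<close>
    have "\<exists>D\<in>extend C P. Suc ` B \<subseteq> D \<and> D \<subseteq> insert 1 (Suc ` B)"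
      using B(1) unfolding extend_def by (cases "B = C") auto
    then obtain D where D: "D\<in>extend C P" "Suc ` B \<subseteq> D" "D \<subseteq> insert 1 (Suc ` B)" by blast
    have "\<forall>x\<in>D. \<not> (Suc i < x \<and> x < Suc j)" using D(3) B(5) by auto
    then show ?thesis unfolding arcs_def using 1 D B by auto
  next
    case 2
    have "Min C \<in> C" using 2 C' by simp
    moreover from this have "1 < Suc (Min C)" using C'(3) by (auto intro: gr0I)
    moreover have "\<not> (1 < x \<and> x < Suc (Min C))" if "x \<in> insert 1 (Suc ` C)" for x
      using that Min_le[OF C'(1)] by (auto simp: not_less)
    moreover have "insert 1 (Suc ` C) \<in> extend C P" unfolding extend_def by simp
    ultimately show ?thesis unfolding arcs_def using 2 by blast
  qed
qed

lemma ne_alt: "ne P = card {(a, b) \<in> arcs P \<times> arcs P. fst a < fst b \<and> fst b < snd b \<and> snd b < snd a}"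
  unfolding ne_def by (rule arg_cong[of _ _ card]) auto

lemma ne_extend_empty:
  assumes P: "P \<in> set_partitions n"
  shows "ne (extend {} P) = ne P"
proof -
  have a: "arcs (extend {} P) = map_prod Suc Suc ` arcs P" using arcs_extend[OF P, of "{}"] by simp
  have "{(a, b) \<in> arcs (extend {} P) \<times> arcs (extend {} P). fst a < fst b \<and> fst b < snd b \<and> snd b < snd a}
      = map_prod (map_prod Suc Suc) (map_prod Suc Suc) `
        {(a, b) \<in> arcs P \<times> arcs P. fst a < fst b \<and> fst b < snd b \<and> snd b < snd a}"
    unfolding a by force
  then show ?thesis unfolding ne_alt
    by (simp add: card_image prod.inj_map inj_on_subset[OF _ subset_UNIV])
qed

text \<open>The new arc starts left of all others, so it can only be the outer arc of a nesting. It
  encloses exactly the shifts of the arcs ending before \<open>Min C\<close>, which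
  \<open>card_arcs_before\<close> counts.\<close>

lemma ne_extend_block:
  assumes P: "P \<in> set_partitions n" and C: "C \<in> P"
  shows "ne (extend C P) = ne P + card ({1..<Min C} - block_mins P)"
proof -
  have C': "finite C" "C \<noteq> {}" "C \<subseteq> {1..n}" using set_partitionsD(5)[OF P C] by auto
  let ?s = "map_prod Suc Suc" and ?e = "(1::nat, Suc (Min C))"
  let ?N = "{(a, b) \<in> arcs P \<times> arcs P. fst a < fst b \<and> fst b < snd b \<and> snd b < snd a}"
  let ?A = "{a \<in> arcs P. snd a < Min C}"
  have a: "arcs (extend C P) = insert ?e (?s ` arcs P)" using arcs_extend[OF P, of C] C C' by simp
  have lt: "fst a < snd a" "1 \<le> fst a" if "a \<in> arcs P" for a
  proof -
    show "fst a < snd a" using that unfolding arcs_def by auto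
    show "1 \<le> fst a" using subsetD[OF finite_arcs(2)[OF P] that] by auto
  qed
  have "{(a, b) \<in> arcs (extend C P) \<times> arcs (extend C P). fst a < fst b \<and> fst b < snd b \<and> snd b < snd a}
      = map_prod ?s ?s ` ?N \<union> Pair ?e ` ?s ` ?A" (is "?L = ?R")
  proof (intro equalityI subsetI)
    fix z assume "z \<in> ?L"
    then obtain x y where z: "z = (x, y)" "x \<in> insert ?e (?s ` arcs P)" "y \<in> insert ?e (?s ` arcs P)"
      "fst x < fst y" "fst y < snd y" "snd y < snd x" unfolding a by blast
    \<comment> \<open>The inner arc starts to the right of another arc, so it cannot start at
      1.\<close>
    have "y \<noteq> ?e" using z lt by fastforce
    then obtain y' where y': "y = ?s y'" "y' \<in> arcs P" using z by auto
    show "z \<in> ?R"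
    proof (cases "x = ?e")
      case True
      then have "y' \<in> ?A" using z y' by auto
      then show ?thesis using z y' True by auto
    next
      case False
      then obtain x' where x': "x = ?s x'" "x' \<in> arcs P" using z by auto
      then have "(x', y') \<in> ?N" using z y' by auto
      then show ?thesis using z(1) x' y' by (intro UnI1 image_eqI[of _ _ "(x', y')"]) auto
    qed
  next
    fix z assume "z \<in> ?R"
    then show "z \<in> ?L"
    proof
      assume "z \<in> map_prod ?s ?s ` ?N" then show ?thesis unfolding a by auto
    next
      assume "z \<in> Pair ?e ` ?s ` ?A"
      then obtain y where "y \<in> ?A" "z = (?e, ?s y)" by auto
      then show ?thesis unfolding a using lt[of y] by (cases y) auto
    qed
  qed
  moreover have "card (map_prod ?s ?s ` ?N \<union> Pair ?e ` ?s ` ?A)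
      = card (map_prod ?s ?s ` ?N) + card (Pair ?e ` ?s ` ?A)"
  proof (rule card_Un_disjoint)
    show "finite (map_prod ?s ?s ` ?N)"
      using finite_arcs(1)[OF P]
      by (intro finite_imageI finite_subset[of ?N "arcs P \<times> arcs P"]) auto
    show "finite (Pair ?e ` ?s ` ?A)" using finite_arcs(1)[OF P] by auto
    show "map_prod ?s ?s ` ?N \<inter> Pair ?e ` ?s ` ?A = {}" using lt(2) by fastforce
  qed
  moreover have "card (map_prod ?s ?s ` ?N) = card ?N"
    by (rule card_image) (simp add: prod.inj_map inj_on_subset[OF _ subset_UNIV])
  moreover have "card (Pair ?e ` ?s ` ?A) = card ?A"
    unfolding image_image by (rule card_image) (auto simp: inj_on_def)
  moreover have "card ?A = card ({1..<Min C} - block_mins P)"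
  proof (rule card_arcs_before[OF P])
    have "Min C \<in> {1..n}" using C' Min_in[of C] by blast
    then show "Min C \<le> n + 1" by simp
  qed
  ultimately show ?thesis unfolding ne_alt by simp
qed

subsection \<open>Equivalence means equal block minima and equal nesting number\<close>

lemma finite_descendants:
  assumes "P \<in> set_partitions n"
  shows "finite (descendants P l)"
proof (rule finite_subset)
  show "descendants P l \<subseteq> {Q. partition_on {1..l + n} Q}"
    using descendants_eq[OF assms] by (auto simp: set_partitions_def)
qed (simp add: finitely_many_partition_on)

text \<open>The ancestor is recovered from \<open>R\<close> by restricting to the last
  \<open>n\<close> elements and shifting. This makes the subtrees below distinct partitions of the
  same size disjoint.\<close>

lemma ancestor_unique:
  assumes "P \<in> set_partitions n" "Q \<in> set_partitions n" "R \<in> descendants P l" "R \<in> descendants Q l"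
  shows "P = Q"
proof -
  have "(`) (\<lambda>i. i - l) ` restrict_partition {l + 1..l + n} R = S"
    if "S \<in> set_partitions n" "R \<in> descendants S l" for S
    using that(2) order_isomorphic_shift_iff[OF _ that(1)] unfolding descendants_eq[OF that(1)] by blast
  then show ?thesis using assms by metis
qed

text \<open>The path is split at its first step, so that an induction on the depth can vary the
  root.\<close>

lemma descendants_Suc:
  assumes "P \<in> set_partitions n"
  shows "descendants P (Suc l) = (\<Union>C\<in>insert {} P. descendants (extend C P) l)"
proof -
  have "(child ^^ Suc l) P Q \<longleftrightarrow> (\<exists>R. child P R \<and> (child ^^ l) R Q)" for Q
    unfolding relpowp_Suc_left by (simp add: OO_def)
  then have "(child ^^ Suc l) P Q \<longleftrightarrow> (\<exists>C\<in>insert {} P. (child ^^ l) (extend C P) Q)" for Q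
    unfolding child_iff_extend[OF assms] by auto
  then show ?thesis unfolding descendants_def by auto
qed

text \<open>By \<open>block_mins_extend\<close>, \<open>ne_extend_empty\<close> and
  \<open>ne_extend_block\<close>, the minima and nesting number of a child depend only on those of
  the parent and on the minimum of the joined block. Matching blocks with equal minima therefore
  pairs the subtrees of \<open>P\<close> with those of \<open>Q\<close>. The predicate
  \<open>\<Phi>\<close> is later used to fix the number of blocks and the nesting number.\<close>

lemma card_descendants_cong:
  assumes "P \<in> set_partitions n" "Q \<in> set_partitions n"
    and "block_mins P = block_mins Q" "ne P = ne Q"
  shows "card {R \<in> descendants P l. \<Phi> (block_mins R) (ne R)} =
         card {R \<in> descendants Q l. \<Phi> (block_mins R) (ne R)}"
  using assms
proof (induction l arbitrary: P Q n)
  case 0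
  have "descendants P 0 = {P}" "descendants Q 0 = {Q}" by (auto simp: descendants_def)
  then have "{R \<in> descendants P 0. \<Phi> (block_mins R) (ne R)} = (if \<Phi> (block_mins P) (ne P) then {P} else {})"
    "{R \<in> descendants Q 0. \<Phi> (block_mins R) (ne R)} = (if \<Phi> (block_mins Q) (ne Q) then {Q} else {})"
    by auto
  then show ?case using 0 by simp
next
  case (Suc l)
  define G where "G C P = card {R \<in> descendants (extend C P) l. \<Phi> (block_mins R) (ne R)}" for C P
  have split: "card {R \<in> descendants P (Suc l). \<Phi> (block_mins R) (ne R)} = G {} P + (\<Sum>C\<in>P. G C P)"
    if P: "P \<in> set_partitions n" for P
  proof -
    have "{R \<in> descendants P (Suc l). \<Phi> (block_mins R) (ne R)} =
        (\<Union>C\<in>insert {} P. {R \<in> descendants (extend C P) l. \<Phi> (block_mins R) (ne R)})"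
      unfolding descendants_Suc[OF P] by blast
    also have "card \<dots> = (\<Sum>C\<in>insert {} P. G C P)"
      unfolding G_def
    proof (rule card_UN_disjoint)
      show "finite (insert {} P)" using set_partitionsD(4)[OF P] by simp
      show "\<forall>C\<in>insert {} P. finite {R \<in> descendants (extend C P) l. \<Phi> (block_mins R) (ne R)}"
        using finite_descendants[OF extend_in_set_partitions[OF P]] by simp
      have "descendants (extend C P) l \<inter> descendants (extend D P) l = {}"
        if "C \<in> insert {} P" "D \<in> insert {} P" "C \<noteq> D" for C D
      proof -
        have "extend C P \<noteq> extend D P" using inj_onD[OF extend_inject[OF P] _ that(1,2)] that(3) by blast
        then show ?thesis
          using ancestor_unique[OF extend_in_set_partitions[OF P that(1)] extend_in_set_partitions[OF P that(2)]]
          by blast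
      qed
      then show "\<forall>C\<in>insert {} P. \<forall>D\<in>insert {} P. C \<noteq> D \<longrightarrow>
          {R \<in> descendants (extend C P) l. \<Phi> (block_mins R) (ne R)} \<inter>
          {R \<in> descendants (extend D P) l. \<Phi> (block_mins R) (ne R)} = {}"
        by blast
    qed
    also have "\<dots> = G {} P + (\<Sum>C\<in>P. G C P)"
      using set_partitionsD(3,4)[OF P] by simp
    finally show ?thesis .
  qed
  note PQ = Suc.prems
  have "G {} P = G {} Q"
    unfolding G_def
  proof (rule Suc.IH[of _ "n + 1"])
    show "extend {} P \<in> set_partitions (n + 1)" "extend {} Q \<in> set_partitions (n + 1)"
      using extend_in_set_partitions PQ by auto
    show "block_mins (extend {} P) = block_mins (extend {} Q)"
      using block_mins_extend[OF PQ(1), of "{}"] block_mins_extend[OF PQ(2), of "{}"] PQ(3) by simp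
    show "ne (extend {} P) = ne (extend {} Q)"
      using ne_extend_empty PQ by simp
  qed
  moreover have "(\<Sum>C\<in>P. G C P) = (\<Sum>C\<in>Q. G C Q)"
  proof (rule sum.reindex_bij_betw[THEN sym, THEN trans])
    \<comment> \<open>Sends a block of \<open>Q\<close> to the block of \<open>P\<close> with the
      same minimum; the sum over \<open>P\<close> is reindexed along this bijection.\<close>
    let ?h = "inv_into P Min \<circ> Min"
    have bQ: "bij_betw Min Q (block_mins Q)"
      using inj_on_Min_blocks[OF PQ(2)] by (simp add: bij_betw_def block_mins_def)
    have bP: "bij_betw Min P (block_mins Q)"
      using inj_on_Min_blocks[OF PQ(1)] PQ(3) by (simp add: bij_betw_def block_mins_def)
    show h: "bij_betw ?h Q P"
      using bij_betw_trans[OF bQ bij_betw_inv_into[OF bP]] .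
    show "(\<Sum>C\<in>Q. G (?h C) P) = (\<Sum>C\<in>Q. G C Q)"
    proof (rule sum.cong[OF refl])
      fix D assume D: "D \<in> Q"
      define C where "C = ?h D"
      have C: "C \<in> P" using bij_betw_apply[OF h D] unfolding C_def .
      have Min: "Min C = Min D"
        unfolding C_def comp_def using bij_betw_inv_into_right[OF bP] bij_betw_apply[OF bQ D] by simp
      have ne: "C \<noteq> {}" "D \<noteq> {}" using C D set_partitionsD(3) PQ by metis+
      have "G C P = G D Q"
        unfolding G_def
      proof (rule Suc.IH[of _ "n + 1"])
        show "extend C P \<in> set_partitions (n + 1)" "extend D Q \<in> set_partitions (n + 1)"
          using extend_in_set_partitions PQ C D by auto
        show "block_mins (extend C P) = block_mins (extend D Q)"
          using block_mins_extend[OF PQ(1), of C] block_mins_extend[OF PQ(2), of D] PQ(3) C D Min ne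
          by simp
        show "ne (extend C P) = ne (extend D Q)"
          using ne_extend_block[OF PQ(1) C] ne_extend_block[OF PQ(2) D] PQ(3,4) Min by simp
      qed
      then show "G (?h D) P = G D Q" unfolding C_def .
    qed
  qed
  ultimately show ?case unfolding split[OF PQ(1)] split[OF PQ(2)] by simp
qed

section \<open>Multisets of nesting numbers and recovery of the block minima\<close>

lemma count_image_mset_set:
  assumes "finite A"
  shows "count (image_mset f (mset_set A)) y = card {x \<in> A. f x = y}"
proof -
  have "count (image_mset f (mset_set A)) y = (\<Sum>x\<in>{x \<in> A. f x = y}. count (mset_set A) x)"
    unfolding count_image_mset' using assms by (intro sum.cong) auto
  also have "\<dots> = (\<Sum>x\<in>{x \<in> A. f x = y}. 1)" using assms by (intro sum.cong) auto
  finally show ?thesis by simp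
qed

text \<open>With \<open>c\<close> the gap count of \<open>d\<close>, the elements of gap count at most \<open>c\<close> in \<open>M\<close> are those below
  \<open>d\<close> and at least one more, while in \<open>N\<close> they all lie below \<open>d\<close>.\<close>

lemma least_difference_contradiction:
  fixes M N :: "nat set"
  assumes "finite M" "finite N"
    and card: "\<And>c. card {m \<in> M. card ({1..<m} - M) \<le> c} = card {m \<in> N. card ({1..<m} - N) \<le> c}"
    and d: "d \<in> M" "d \<notin> N" "1 \<le> d" and less: "\<And>e. e < d \<Longrightarrow> e \<in> M \<longleftrightarrow> e \<in> N"
  shows False
proof -
  define c where "c = card ({1..<d} - M)"
  have "insert d {m \<in> M. m < d} \<subseteq> {m \<in> M. card ({1..<m} - M) \<le> c}"
    unfolding c_def using d(1) by (auto intro!: card_mono)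
  moreover have "{m \<in> N. card ({1..<m} - N) \<le> c} \<subseteq> {m \<in> M. m < d}"
  proof
    fix m assume m: "m \<in> {m \<in> N. card ({1..<m} - N) \<le> c}"
    have "m < d"
    proof (rule ccontr)
      assume "\<not> m < d"
      then have "d < m" using m d(2) by (cases "m = d") auto
      \<comment> \<open>Beyond \<open>d\<close>, the missing element \<open>d\<close> is itself an
        additional gap of \<open>N\<close>, so the gap count exceeds \<open>c\<close>.\<close>
      then have "insert d ({1..<d} - M) \<subseteq> {1..<m} - N" using d less by auto
      then have "card (insert d ({1..<d} - M)) \<le> card ({1..<m} - N)" by (intro card_mono) auto
      then show False using m unfolding c_def by simp
    qed
    then show "m \<in> {m \<in> M. m < d}" using m less by auto
  qed
  ultimately have "insert d {m \<in> M. m < d} \<subseteq> {m \<in> M. card ({1..<m} - M) \<le> c}"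
    "card {m \<in> M. card ({1..<m} - M) \<le> c} \<le> card {m \<in> M. m < d}"
    using card[of c] card_mono[of "{m \<in> M. m < d}"] \<open>finite M\<close> by simp_all
  moreover have "card (insert d {m \<in> M. m < d}) = Suc (card {m \<in> M. m < d})"
    using \<open>finite M\<close> by simp
  ultimately show False
    using card_mono[of "{m \<in> M. card ({1..<m} - M) \<le> c}" "insert d {m \<in> M. m < d}"] \<open>finite M\<close> by simp
qed

text \<open>The least element of the symmetric difference lies in one of the two sets, and
  \<open>least_difference_contradiction\<close> applies in that order. Positivity matters: 0 and 1
  both have gap count 0, so {0} and {1} could not be told apart.\<close>

lemma eq_if_same_gap_counts:
  fixes M N :: "nat set"
  assumes fin: "finite M" "finite N" and pos: "0 \<notin> M" "0 \<notin> N"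
    and card: "\<And>c. card {m \<in> M. card ({1..<m} - M) \<le> c} = card {m \<in> N. card ({1..<m} - N) \<le> c}"
  shows "M = N"
proof (rule ccontr)
  assume "M \<noteq> N"
  then have ex: "\<exists>d. (d \<in> M) \<noteq> (d \<in> N)" by auto
  define d where "d = (LEAST d. (d \<in> M) \<noteq> (d \<in> N))"
  have d: "(d \<in> M) \<noteq> (d \<in> N)" unfolding d_def using ex by (rule LeastI_ex)
  have less: "e \<in> M \<longleftrightarrow> e \<in> N" if "e < d" for e using that not_less_Least unfolding d_def by blast
  have "1 \<le> d" using d pos by (cases d) auto
  then show False
    using least_difference_contradiction[of M N d] least_difference_contradiction[of N M d]
      fin card d less by auto
qed

lemma ne_sim_iff:
  assumes "P \<in> set_partitions_blocks n k" "Q \<in> set_partitions_blocks n k"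
  shows "ne_sim P Q \<longleftrightarrow> block_mins P = block_mins Q \<and> ne P = ne Q"
proof
  have P: "P \<in> set_partitions n" and Q: "Q \<in> set_partitions n"
    and k: "card P = k" "card Q = k" using assms by (auto simp: set_partitions_blocks_def)
  {
    assume eq: "block_mins P = block_mins Q \<and> ne P = ne Q"
    \<comment> \<open>The number of blocks equals the number of minima, which brings the level into
      the form required by \<open>card_descendants_cong\<close>.\<close>
    have "{R \<in> tree_level P l m. ne R = y} = {R \<in> descendants P l. card (block_mins R) = m \<and> ne R = y}"
      if P: "P \<in> set_partitions n" for P l m y
      using descendants_eq[OF P] card_block_mins unfolding tree_level_def by auto
    then have "count (image_mset ne (mset_set (tree_level P l m))) y =
        count (image_mset ne (mset_set (tree_level Q l m))) y" for l m y
      unfolding count_image_mset_set[OF finite_tree_level[OF P]] count_image_mset_set[OF finite_tree_level[OF Q]]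
      using P Q card_descendants_cong[OF P Q, of l "\<lambda>M x. card M = m \<and> x = y"] eq by simp
    then show "ne_sim P Q" unfolding ne_sim_def by (intro allI multiset_eqI) blast
  }
  assume sim: "ne_sim P Q"
  have "tree_level P 0 k = {P}" "tree_level Q 0 k = {Q}"
    using k by (auto simp: tree_level_def descendants_def)
  moreover have "image_mset ne (mset_set (tree_level P 0 k)) = image_mset ne (mset_set (tree_level Q 0 k))"
    using sim unfolding ne_sim_def by blast
  ultimately have ne: "ne P = ne Q" by simp
  \<comment> \<open>Only the children joining 1 to a block keep \<open>k\<close> blocks; a new
    singleton gives \<open>k + 1\<close>. So this level lists one nesting number per block minimum,
    namely \<open>ne P\<close> plus the gap count, and the threshold \<open>ne P + c\<close> selects
    the gap counts up to \<open>c\<close>.\<close>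
  have level1: "card {m \<in> block_mins P. card ({1..<m} - block_mins P) \<le> c} =
      size (filter_mset (\<lambda>y. y \<le> ne P + c) (image_mset ne (mset_set (tree_level P 1 k))))"
    if P: "P \<in> set_partitions n" and k: "card P = k" for P c
  proof -
    have cardC: "card (extend C P) = k" if "C \<in> P" for C
    proof -
      have mC: "Min C \<in> block_mins P" using that unfolding block_mins_def by blast
      have fin: "finite (block_mins P)" using set_partitionsD(4)[OF P] by (simp add: block_mins_def)
      have "C \<noteq> {}" using that set_partitionsD(3)[OF P] by auto
      then have "block_mins (extend C P) = insert 1 (Suc ` (block_mins P - {Min C}))"
        using block_mins_extend[OF P, of C] that by simp
      moreover have "1 \<notin> Suc ` (block_mins P - {Min C})" using block_mins_subset[OF P] by auto
      ultimately have "card (block_mins (extend C P)) = Suc (card (block_mins P - {Min C}))"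
        using fin by (simp add: card_image)
      also have "\<dots> = card (block_mins P)" using mC fin by (metis card_Suc_Diff1)
      finally show ?thesis
        using card_block_mins[OF P] card_block_mins[OF extend_in_set_partitions[OF P]] that k by simp
    qed
    have card0: "card (extend {} P) \<noteq> k"
    proof -
      have "1 \<notin> Suc ` block_mins P" using block_mins_subset[OF P] by auto
      then have "card (block_mins (extend {} P)) = Suc (card (block_mins P))"
        using block_mins_extend[OF P, of "{}"] set_partitionsD(4)[OF P]
        by (simp add: card_image block_mins_def)
      then show ?thesis
        using card_block_mins[OF P] card_block_mins[OF extend_in_set_partitions[OF P]] k by simp
    qed
    have "descendants P 1 = (\<lambda>C. extend C P) ` insert {} P"
      unfolding descendants_def using child_iff_extend[OF P] by auto
    then have "tree_level P 1 k = (\<lambda>C. extend C P) ` P"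
      unfolding tree_level_def using cardC card0 by auto
    then have "mset_set (tree_level P 1 k) = image_mset (\<lambda>C. extend C P) (mset_set P)"
      using image_mset_mset_set[OF inj_on_subset[OF extend_inject[OF P]], of P]
      subset_insertI[of P "{}"] by simp
    then have "image_mset ne (mset_set (tree_level P 1 k)) =
        image_mset (\<lambda>C. ne (extend C P)) (mset_set P)" by (simp add: image_mset.compositionality comp_def)
    also have "\<dots> = image_mset (\<lambda>C. ne P + card ({1..<Min C} - block_mins P)) (mset_set P)"
      using ne_extend_block[OF P] set_partitionsD(4)[OF P] by (intro image_mset_cong) simp
    also have "\<dots> = image_mset (\<lambda>m. ne P + card ({1..<m} - block_mins P)) (image_mset Min (mset_set P))"
      by (simp add: image_mset.compositionality comp_def)
    also have "image_mset Min (mset_set P) = mset_set (block_mins P)"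
      unfolding block_mins_def by (rule image_mset_mset_set[OF inj_on_Min_blocks[OF P]])
    finally show ?thesis
      using set_partitionsD(4)[OF P] by (simp add: filter_mset_image_mset block_mins_def)
  qed
  have "block_mins P = block_mins Q"
  proof (rule eq_if_same_gap_counts)
    show "finite (block_mins P)" "finite (block_mins Q)"
      using set_partitionsD(4) P Q by (auto simp: block_mins_def)
    show "0 \<notin> block_mins P" "0 \<notin> block_mins Q" using block_mins_subset P Q by fastforce+
    show "card {m \<in> block_mins P. card ({1..<m} - block_mins P) \<le> c} =
        card {m \<in> block_mins Q. card ({1..<m} - block_mins Q) \<le> c}" for c
      unfolding level1[OF P k(1)] level1[OF Q k(2)] ne using sim unfolding ne_sim_def by metis
  qed
  then show "block_mins P = block_mins Q \<and> ne P = ne Q" using ne by blast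
qed

subsection \<open>Nesting numbers of partitions with prescribed block minima\<close>

text \<open>A partition of [n] with block minima \<open>M\<close> has \<open>n - card M\<close>
  arcs. That this sum is the largest nesting number for these minima follows from
  \<open>ne_le_bound\<close> and \<open>ex_partition_of_type\<close>.\<close>

definition ne_bound :: "nat \<Rightarrow> nat set \<Rightarrow> nat" where
  "ne_bound n M = (\<Sum>p = 1..n - card M. card (M \<inter> {2..p}))"

text \<open>Ground set and set of minima both grow by one, so the range of \<open>p\<close> keeps
  the length \<open>n - card L\<close>; undoing the shift turns the window \<open>{2..p}\<close>
  into \<open>{1..<p}\<close>. In applications \<open>L\<close> is the set of parent minima, without
  the joined one if 1 joins a block.\<close>

lemma ne_bound_Suc:
  assumes "L \<subseteq> {1..n}"
  shows "ne_bound (Suc n) (insert 1 (Suc ` L)) = (\<Sum>p = 1..n - card L. card (L \<inter> {1..<p}))"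
proof -
  have "finite L" "1 \<notin> Suc ` L" using assms finite_subset by auto
  then have "card (insert 1 (Suc ` L)) = Suc (card L)" by (simp add: card_image)
  moreover have "insert 1 (Suc ` L) \<inter> {2..p} = Suc ` (L \<inter> {1..<p})" for p
    using assms by auto
  ultimately show ?thesis unfolding ne_bound_def by (simp add: card_image)
qed

text \<open>Termwise, the window \<open>{1..<p}\<close> gains the minimum 1 and loses at most
  \<open>p\<close> compared with \<open>{2..p}\<close>.\<close>

lemma ne_bound_le:
  assumes "L \<subseteq> {1..n}" "1 \<le> n \<longrightarrow> 1 \<in> L"
  shows "ne_bound n L \<le> ne_bound (Suc n) (insert 1 (Suc ` L))"
  unfolding ne_bound_Suc[OF assms(1)] unfolding ne_bound_def
proof (rule sum_mono)
  fix p assume p: "p \<in> {1..n - card L}"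
  then have "1 \<in> L" using assms(2) by auto
  then have "insert 1 (L \<inter> {2..p}) \<subseteq> insert p (L \<inter> {1..<p})" using p by auto
  then have "card (insert 1 (L \<inter> {2..p})) \<le> card (insert p (L \<inter> {1..<p}))" by (intro card_mono) auto
  then show "card (L \<inter> {2..p}) \<le> card (L \<inter> {1..<p})" by simp
qed

text \<open>The increase of the bound when 1 joins the block with minimum \<open>m\<close>. After
  reindexing, the terms on the left exceed those on the right by one exactly for
  \<open>p < m\<close>, and \<open>p\<close> runs up to \<open>n - card L - 1\<close>, the number of
  arcs of the parent.\<close>

lemma ne_bound_insert:
  assumes L: "L \<subseteq> {1..n}" and m: "m \<in> {1..n} - L" and one: "1 \<in> insert m L"
  shows "ne_bound (Suc n) (insert 1 (Suc ` L)) = ne_bound n (insert m L) + min (n - card L - 1) (m - 1)"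
proof -
  have fin: "finite L" using L finite_subset by auto
  have "card (insert m L) \<le> card {1..n}" using L m by (intro card_mono) auto
  then have "Suc (card L) \<le> n" using m fin by simp
  then obtain K where K: "n = Suc (card L) + K" using le_Suc_ex by blast
  have "card (insert m L \<inter> {2..p}) + 1 = card (L \<inter> {1..<Suc p}) + of_bool (m \<le> p)" if "p \<in> {1..K}" for p
  proof -
    \<comment> \<open>Restoring 1, which is \<open>m\<close> or lies in \<open>L\<close>, makes both
      windows equal to \<open>{1..p}\<close>.\<close>
    have "insert 1 (insert m L \<inter> {2..p}) = (if m \<le> p then {m} else {}) \<union> (L \<inter> {1..<Suc p})"
      using one that m L by auto
    moreover have "card \<dots> = card (L \<inter> {1..<Suc p}) + of_bool (m \<le> p)" using m by simp
    ultimately have "card (insert 1 (insert m L \<inter> {2..p})) = card (L \<inter> {1..<Suc p}) + of_bool (m \<le> p)"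
      by simp
    then show ?thesis by simp
  qed
  then have "(\<Sum>p=1..K. card (insert m L \<inter> {2..p}) + 1) =
      (\<Sum>p=1..K. card (L \<inter> {1..<Suc p}) + of_bool (m \<le> p))" by (intro sum.cong) auto
  then have 1: "(\<Sum>p=1..K. card (insert m L \<inter> {2..p})) + K =
      (\<Sum>p=1..K. card (L \<inter> {1..<Suc p})) + (\<Sum>p=1..K. of_bool (m \<le> p))"
    unfolding sum.distrib by simp
  have "(\<Sum>p=1..K. of_bool (m \<le> p) + of_bool (p < m)) = (\<Sum>p=1..K. 1::nat)"
    by (intro sum.cong) auto
  then have 2: "(\<Sum>p=1..K. of_bool (m \<le> p)) + (\<Sum>p=1..K. of_bool (p < m)) = K"
    unfolding sum.distrib by simp
  have "(\<Sum>p=1..K. of_bool (p < m) :: nat) = card ({1..K} \<inter> {p. p < m})" by simp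
  also have "{1..K} \<inter> {p. p < m} = {1..min K (m - 1)}" using m by auto
  finally have 3: "(\<Sum>p=1..K. of_bool (p < m)) = min K (m - 1)" by simp
  have "ne_bound (Suc n) (insert 1 (Suc ` L)) = (\<Sum>p=1..Suc K. card (L \<inter> {1..<p}))"
    unfolding ne_bound_Suc[OF L] using K by simp
  \<comment> \<open>The first window is empty, so the range of length \<open>Suc K\<close> reduces
    to \<open>1..K\<close> after the shift.\<close>
  also have "\<dots> = (\<Sum>p=0..K. card (L \<inter> {1..<Suc p}))"
    using sum.shift_bounds_cl_Suc_ivl[of "\<lambda>p. card (L \<inter> {1..<p})" 0 K] by simp
  also have "\<dots> = (\<Sum>p=1..K. card (L \<inter> {1..<Suc p}))"
    by (simp add: sum.atLeast_Suc_atMost)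
  finally have "ne_bound (Suc n) (insert 1 (Suc ` L)) = (\<Sum>p=1..K. card (L \<inter> {1..<Suc p}))" .
  moreover have "ne_bound n (insert m L) = (\<Sum>p=1..K. card (insert m L \<inter> {2..p}))"
    unfolding ne_bound_def using K m fin by simp
  moreover have "n - card L - 1 = K" using K by simp
  ultimately show ?thesis using 1 2 3 by linarith
qed

text \<open>Provides a block minimum for which the new arc covers a prescribed number of
  arcs.\<close>

lemma ex_element_of_rank:
  fixes S :: "nat set"
  assumes "finite S" "c < card S"
  shows "\<exists>m\<in>S. card {y \<in> S. y < m} = c"
  using assms
proof (induction S rule: finite_linorder_max_induct)
  case (insert b A)
  show ?case
  proof (cases "c < card A")
    case True
    then obtain m where m: "m \<in> A" "card {y \<in> A. y < m} = c" using insert by blast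
    moreover have "{y \<in> insert b A. y < m} = {y \<in> A. y < m}" using insert m by auto
    ultimately show ?thesis by (intro bexI[of _ m]) simp_all
  next
    case False
    have "b \<notin> A" using insert by auto
    then have "c = card A" using False insert by simp
    moreover have "{y \<in> insert b A. y < b} = A" using insert by auto
    ultimately show ?thesis by (intro bexI[of _ b]) simp_all
  qed
qed simp

lemma set_partitions_Suc:
  "set_partitions (Suc n) = (\<Union>P\<in>set_partitions n. (\<lambda>C. extend C P) ` insert {} P)"
proof (intro equalityI subsetI)
  fix Q assume Q: "Q \<in> set_partitions (Suc n)"
  let ?P = "(`) (\<lambda>i. i - 1) ` restrict_partition {2..n + 1} Q"
  have "?P \<in> set_partitions n"
    using shift_restrict_in_set_partitions[of Q 1 n] Q by (simp add: numeral_2_eq_2)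
  then show "Q \<in> (\<Union>P\<in>set_partitions n. (\<lambda>C. extend C P) ` insert {} P)"
    using extend_parent[of Q n ?P] Q by auto
qed (use extend_in_set_partitions in auto)

lemma ne_empty: "ne {} = 0"
  by (simp add: ne_def arcs_def case_prod_unfold)

text \<open>Induction by removing the first element. A new singleton leaves \<open>ne\<close>
  unchanged while the bound does not drop; a new arc covers at most as many arcs as the increment in
  \<open>ne_bound_insert\<close>.\<close>

lemma ne_le_bound:
  assumes "P \<in> set_partitions n"
  shows "ne P \<le> ne_bound n (block_mins P)"
  using assms
proof (induction n arbitrary: P)
  case 0
  then show ?case by (simp add: set_partitions_0 ne_empty)
next
  case (Suc n)
  then obtain R C where R: "R \<in> set_partitions n" and C: "C \<in> insert {} R" and P: "P = extend C R"
    unfolding set_partitions_Suc by blast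
  let ?M = "block_mins R"
  have M: "?M \<subseteq> {1..n}" using block_mins_subset[OF R] .
  have one: "1 \<in> ?M" if "1 \<le> n" using one_in_block_mins[OF R that] .
  show ?case
  proof (cases "C = {}")
    case True
    have "ne P \<le> ne_bound n ?M" using Suc.IH[OF R] ne_extend_empty[OF R] True P by simp
    also have "\<dots> \<le> ne_bound (Suc n) (insert 1 (Suc ` ?M))" using ne_bound_le[OF M] one by simp
    also have "insert 1 (Suc ` ?M) = block_mins P"
      using block_mins_extend[OF R C] True P by simp
    finally show ?thesis .
  next
    case False
    then have CR: "C \<in> R" using C by simp
    define m where "m = Min C"
    define L where "L = ?M - {m}"
    have m: "m \<in> ?M" unfolding m_def block_mins_def using CR by blast
    then have Lm: "insert m L = ?M" "m \<notin> L" unfolding L_def by auto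
    have mn: "m \<in> {1..n} - L" using m M Lm by auto
    have L: "L \<subseteq> {1..n}" using M unfolding L_def by auto
    have fin: "finite L" using L finite_subset by auto
    have "1 \<le> n" using mn by auto
    note bound = ne_bound_insert[OF L mn, unfolded Lm(1), OF one[OF this]]
    \<comment> \<open>The covered arcs are limited both by the \<open>m - 1\<close> positions before
      \<open>m\<close> and by the total number of arcs of \<open>R\<close>.\<close>
    have "card ({1..<m} - ?M) \<le> card {1..<m}" by (intro card_mono) auto
    moreover have "card ({1..<m} - ?M) \<le> card ({1..n} - ?M)" using mn by (intro card_mono) auto
    moreover have "card ({1..n} - ?M) = n - card L - 1"
      using Lm M fin card_Diff_subset[of ?M "{1..n}"] finite_subset[OF M] card_insert_disjoint[OF fin Lm(2)] by simp
    ultimately have le: "card ({1..<m} - ?M) \<le> min (n - card L - 1) (m - 1)" by simp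
    have "ne P = ne R + card ({1..<m} - ?M)"
      using ne_extend_block[OF R CR] P unfolding m_def by simp
    moreover have "block_mins P = insert 1 (Suc ` L)"
      using block_mins_extend[OF R C] False P unfolding L_def m_def by simp
    ultimately show ?thesis using add_mono[OF Suc.IH[OF R] le] bound by simp
  qed
qed

text \<open>Induction that reverses the addition of a first element: choose the minimum
  \<open>m\<close> of the block to be joined, and let the parent supply what the new arc does not
  contribute to \<open>x\<close>.\<close>

lemma ex_partition_of_type:
  assumes "M \<subseteq> {1..n}" "1 \<le> n \<longrightarrow> 1 \<in> M" "x \<le> ne_bound n M"
  shows "\<exists>P\<in>set_partitions n. block_mins P = M \<and> ne P = x"
  using assms
proof (induction n arbitrary: M x)
  case 0
  then show ?case
    by (simp add: set_partitions_0 ne_empty block_mins_def ne_bound_def)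
next
  case (Suc n)
  \<comment> \<open>The minima of the parent, except for the one that disappears if 1 joins a
    block.\<close>
  define L where "L = {i. Suc i \<in> M \<and> 1 \<le> i}"
  have L: "L \<subseteq> {1..n}" unfolding L_def using Suc.prems(1) by auto
  have fin: "finite L" using L finite_subset by auto
  have "M - {1} = Suc ` L"
  proof (intro equalityI subsetI)
    fix y assume y: "y \<in> M - {1}"
    then have "y \<ge> 2" using Suc.prems(1) by (auto simp: numeral_2_eq_2 le_eq_less_or_eq)
    then have "y = Suc (y - 1)" "y - 1 \<in> L" using y unfolding L_def by auto
    then show "y \<in> Suc ` L" by blast
  qed (auto simp: L_def)
  then have M: "M = insert 1 (Suc ` L)" using Suc.prems(2) by auto
  \<comment> \<open>Here \<open>m\<close> is the vanishing minimum, so the parent has minima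
    \<open>insert m L\<close>; the new arc contributes \<open>c\<close> and the parent
    \<open>x - c\<close>.\<close>
  have join: ?case
    if m: "m \<in> {1..n} - L" and one: "1 \<in> insert m L" and c: "c = card ({1..<m} - L)" "c \<le> x"
      and x: "x - c \<le> ne_bound n (insert m L)" for m c
  proof -
    have "insert m L \<subseteq> {1..n}" using m L by auto
    from Suc.IH[OF this _ x] one obtain P where P: "P \<in> set_partitions n"
      "block_mins P = insert m L" "ne P = x - c" by auto
    then obtain C where C: "C \<in> P" "Min C = m" unfolding block_mins_def by (metis imageE insertI1)
    have "C \<noteq> {}" using C set_partitionsD(3)[OF P(1)] by auto
    then have "block_mins (extend C P) = insert 1 (Suc ` (insert m L - {m}))"
      using block_mins_extend[OF P(1), of C] C P by simp
    also have "insert m L - {m} = L" using m by auto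
    finally have "block_mins (extend C P) = M" unfolding M .
    moreover have "{1..<m} - insert m L = {1..<m} - L" by auto
    then have "ne (extend C P) = x"
      using ne_extend_block[OF P(1) C(1)] C(2) P(2,3) c by simp
    ultimately show ?thesis using extend_in_set_partitions[OF P(1), of C] C by auto
  qed
  show ?case
  proof (cases "{1..n} - L = {}")
    case True
    then have Ln: "L = {1..n}" using L by auto
    \<comment> \<open>No minimum can have vanished, so 1 must be a singleton; the range of the sum
      is empty.\<close>
    then have "x = 0" using Suc.prems(3) unfolding M ne_bound_Suc[OF L] by simp
    obtain P where P: "P \<in> set_partitions n" "block_mins P = L" "ne P = 0"
      using Suc.IH[of L 0] L Ln by auto
    have "block_mins (extend {} P) = M" using block_mins_extend[OF P(1), of "{}"] P(2) M by simp
    moreover have "ne (extend {} P) = x" using ne_extend_empty[OF P(1)] P(3) \<open>x = 0\<close> by simp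
    ultimately show ?thesis using extend_in_set_partitions[OF P(1), of "{}"] by auto
  next
    case False
    show ?thesis
    proof (cases "1 \<in> L")
      case False
      \<comment> \<open>The parent needs 1 among its minima, which forces \<open>m = 1\<close>. The
        new arc covers nothing and the bound does not change.\<close>
      have m: "1 \<in> {1..n} - L" using False \<open>{1..n} - L \<noteq> {}\<close> by auto
      show ?thesis
        using join[OF m, of 0] Suc.prems(3) ne_bound_insert[OF L m] M by simp
    next
      case True
      let ?K = "n - card L - 1"
      have cK: "card ({1..n} - L) = Suc ?K"
      proof -
        have "card ({1..n} - L) = n - card L" using card_Diff_subset[OF fin L] by simp
        moreover have "card ({1..n} - L) \<noteq> 0" using False by simp
        ultimately show ?thesis by simp
      qed
      \<comment> \<open>Either the new arc alone accounts for \<open>x\<close>, or it covers as many arcs as possible.\<close>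
      define c where "c = min x ?K"
      have "c < card ({1..n} - L)" unfolding cK c_def by simp
      then obtain m where m: "m \<in> {1..n} - L" "card {y \<in> {1..n} - L. y < m} = c"
        using ex_element_of_rank[of "{1..n} - L" c] by auto
      have "{y \<in> {1..n} - L. y < m} = {1..<m} - L" using m(1) by auto
      then have c: "c = card ({1..<m} - L)" using m(2) by simp
      note bound = ne_bound_insert[OF L m(1)]
      \<comment> \<open>If \<open>c = x\<close>, nothing remains; if \<open>c = ?K\<close>, the
        bound has grown by at most \<open>?K\<close>.\<close>
      have "x - c \<le> ne_bound n (insert m L)"
        using Suc.prems(3) bound True M unfolding c_def by (auto simp: min_def split: if_splits)
      then show ?thesis using join[OF m(1) _ c] True unfolding c_def by simp
    qed
  qed
qed

subsection \<open>Counting the classes\<close>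

text \<open>The classes are the fibres of \<open>g\<close>; below, \<open>g\<close> is the pair of
  block minima and nesting number.\<close>

lemma card_quotient_kernel:
  assumes "\<And>x y. (x, y) \<in> r \<longleftrightarrow> x \<in> A \<and> y \<in> A \<and> g x = g y"
  shows "card (A // r) = card (g ` A)"
proof -
  have "r `` {x} = {y \<in> A. g y = g x}" if "x \<in> A" for x using assms that by auto
  then have "A // r = (\<lambda>x. {y \<in> A. g y = g x}) ` A" unfolding quotient_def by auto
  also have "\<dots> = (\<lambda>v. {y \<in> A. g y = v}) ` g ` A" by (simp add: image_image)
  also have "card \<dots> = card (g ` A)" by (rule card_image) (auto simp: inj_on_def)
  finally show ?thesis .
qed

lemma card_subsets_containing:
  assumes "finite A" "T \<subseteq> A" "card T \<le> k"
  shows "card {M. M \<subseteq> A \<and> T \<subseteq> M \<and> card M = k} = (card A - card T) choose (k - card T)"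
proof -
  have fT: "finite T" using assms finite_subset by blast
  have "bij_betw (\<lambda>M. M - T) {M. M \<subseteq> A \<and> T \<subseteq> M \<and> card M = k} {M. M \<subseteq> A - T \<and> card M = k - card T}"
  proof (rule bij_betw_byWitness[where f' = "\<lambda>M. M \<union> T"])
    show "(\<lambda>M. M - T) ` {M. M \<subseteq> A \<and> T \<subseteq> M \<and> card M = k} \<subseteq> {M. M \<subseteq> A - T \<and> card M = k - card T}"
      using fT by (auto simp: card_Diff_subset)
    show "(\<lambda>M. M \<union> T) ` {M. M \<subseteq> A - T \<and> card M = k - card T} \<subseteq> {M. M \<subseteq> A \<and> T \<subseteq> M \<and> card M = k}"
    proof (intro image_subsetI CollectI conjI)
      fix M assume M: "M \<in> {M. M \<subseteq> A - T \<and> card M = k - card T}"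
      then have "finite M" using assms(1) finite_subset by blast
      moreover have "M \<inter> T = {}" using M by auto
      ultimately show "card (M \<union> T) = k" using M assms(3) fT by (simp add: card_Un_disjoint)
    qed (use assms in auto)
  qed auto
  then have "card {M. M \<subseteq> A \<and> T \<subseteq> M \<and> card M = k} = card {M. M \<subseteq> A - T \<and> card M = k - card T}"
    by (rule bij_betw_same_card)
  also have "\<dots> = card (A - T) choose (k - card T)" using assms(1) by (intro n_subsets) simp
  finally show ?thesis using assms fT by (simp add: card_Diff_subset)
qed

text \<open>For each possible set of minima the nesting numbers run from 0 to
  \<open>ne_bound n M\<close>, hence the \<open>Suc\<close>. The condition
  \<open>{1} \<subseteq> M\<close> is phrased to fit \<open>card_subsets_containing\<close>.\<close>

lemma ne_class_count_eq_sum: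
  assumes "1 \<le> n"
  shows "ne_class_count n k = (\<Sum>M | M \<subseteq> {1..n} \<and> {1} \<subseteq> M \<and> card M = k. Suc (ne_bound n M))"
proof -
  let ?t = "\<lambda>P. (block_mins P, ne P)"
  have "ne_class_count n k = card (?t ` set_partitions_blocks n k)"
    unfolding ne_class_count_def by (rule card_quotient_kernel) (use ne_sim_iff in \<open>auto simp: ne_rel_def\<close>)
  also have "?t ` set_partitions_blocks n k =
      (SIGMA M:{M. M \<subseteq> {1..n} \<and> {1} \<subseteq> M \<and> card M = k}. {..ne_bound n M})" (is "?I = ?S")
  proof (intro equalityI subsetI)
    fix z assume "z \<in> ?I"
    then show "z \<in> ?S"
      using block_mins_subset one_in_block_mins[OF _ assms] ne_le_bound card_block_mins
      unfolding set_partitions_blocks_def by auto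
  next
    fix z assume "z \<in> ?S"
    then obtain M x where z: "z = (M, x)" and M: "M \<subseteq> {1..n}" "1 \<in> M" "card M = k" "x \<le> ne_bound n M"
      by auto
    then obtain P where "P \<in> set_partitions n" "block_mins P = M" "ne P = x"
      using ex_partition_of_type[of M n x] by auto
    then show "z \<in> ?I"
      using z M(3) card_block_mins unfolding set_partitions_blocks_def by force
  qed
  also have "card ?S = (\<Sum>M | M \<subseteq> {1..n} \<and> {1} \<subseteq> M \<and> card M = k. Suc (ne_bound n M))"
    by (subst card_SigmaI) auto
  finally show ?thesis .
qed

text \<open>Double counting: each \<open>q\<close> in \<open>{2..p}\<close> lies in as many of the
  sets \<open>M\<close> as there are ways to complete \<open>{1, q}\<close> to \<open>k\<close>
  elements.\<close>

lemma sum_card_Int_subsets: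
  assumes "2 \<le> k" "p \<le> n"
  shows "(\<Sum>M | M \<subseteq> {1..n} \<and> {1} \<subseteq> M \<and> card M = k. card (M \<inter> {2..p})) =
         (p - 1) * ((n - 2) choose (k - 2))"
proof -
  let ?F = "{M. M \<subseteq> {1..n} \<and> {1} \<subseteq> M \<and> card M = k}"
  have fin: "finite ?F" by simp
  have "(\<Sum>M\<in>?F. card (M \<inter> {2..p})) = (\<Sum>M\<in>?F. \<Sum>q=2..p. of_bool (q \<in> M))"
    by (simp add: Int_commute)
  also have "\<dots> = (\<Sum>q=2..p. \<Sum>M\<in>?F. of_bool (q \<in> M))" by (rule sum.swap)
  also have "\<dots> = (\<Sum>q=2..p. (n - 2) choose (k - 2))"
  proof (rule sum.cong[OF refl])
    fix q assume q: "q \<in> {2..p}"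
    have "(\<Sum>M\<in>?F. of_bool (q \<in> M)) = card (?F \<inter> {M. q \<in> M})" using fin by simp
    also have "?F \<inter> {M. q \<in> M} = {M. M \<subseteq> {1..n} \<and> {1, q} \<subseteq> M \<and> card M = k}" by auto
    also have "card \<dots> = (card {1..n} - card {1, q}) choose (k - card {1, q})"
      using q assms by (intro card_subsets_containing) auto
    also have "card {1, q} = 2" using q by auto
    finally show "(\<Sum>M\<in>?F. of_bool (q \<in> M)) = (n - 2) choose (k - 2)" by simp
  qed
  also have "\<dots> = (p - 1) * ((n - 2) choose (k - 2))" by simp
  finally show ?thesis .
qed

lemma ne_class_count_closed_form:
  assumes "1 \<le> k" "k \<le> n"
  shows "ne_class_count n k = ((n - 1) choose (k - 1)) + (k choose 2) * ((n - 2) choose k)"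
proof -
  let ?F = "{M. M \<subseteq> {1..n} \<and> {1} \<subseteq> M \<and> card M = k}"
  have "card ?F = (card {1..n} - card {1::nat}) choose (k - card {1::nat})"
    using assms by (intro card_subsets_containing) auto
  then have cF: "card ?F = (n - 1) choose (k - 1)" by simp
  have "ne_class_count n k = card ?F + (\<Sum>M\<in>?F. ne_bound n M)"
    using assms by (simp add: ne_class_count_eq_sum sum_Suc)
  also have "(\<Sum>M\<in>?F. ne_bound n M) = (k choose 2) * ((n - 2) choose k)"
  \<comment> \<open>For \<open>k = 1\<close> the subtraction in \<open>k - 2\<close> would truncate;
    then \<open>M = {1}\<close> and the bound vanishes.\<close>
  proof (cases "k = 1")
    case True
    have "ne_bound n M = 0" if "M \<in> ?F" for M
    proof -
      have "M = {1}" using that True by (auto simp: card_1_singleton_iff)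
      then show ?thesis unfolding ne_bound_def by simp
    qed
    then show ?thesis using True by simp
  next
    case False
    then have k: "2 \<le> k" using assms by simp
    have "(\<Sum>M\<in>?F. ne_bound n M) = (\<Sum>M\<in>?F. \<Sum>p=1..n - k. card (M \<inter> {2..p}))"
      unfolding ne_bound_def by (intro sum.cong) auto
    also have "\<dots> = (\<Sum>p=1..n - k. \<Sum>M\<in>?F. card (M \<inter> {2..p}))" by (rule sum.swap)
    also have "\<dots> = (\<Sum>p=1..n - k. (p - 1) * ((n - 2) choose (k - 2)))"
      using sum_card_Int_subsets[OF k] by (intro sum.cong) auto
    also have "\<dots> = (\<Sum>p=1..n - k. p - 1) * ((n - 2) choose (k - 2))" by (simp add: sum_distrib_right)
    also have "(\<Sum>p=1..j. p - 1) = j choose 2" for j :: nat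
      by (induction j) (auto simp: numeral_2_eq_2)
    \<comment> \<open>Both sides count nested choices of \<open>k - 2\<close> elements inside
      \<open>k\<close> elements out of \<open>n - 2\<close>. If \<open>k > n - 2\<close>, then
      \<open>n - k < 2\<close> and both vanish.\<close>
    also have "((n - k) choose 2) * ((n - 2) choose (k - 2)) = (k choose 2) * ((n - 2) choose k)"
    proof (cases "k \<le> n - 2")
      case True
      have "((n - 2) choose k) * (k choose (k - 2)) =
          ((n - 2) choose (k - 2)) * ((n - 2 - (k - 2)) choose (k - (k - 2)))"
        using True by (intro choose_mult) auto
      moreover have "k choose (k - 2) = k choose 2" using binomial_symmetric[OF k] by simp
      moreover have "n - 2 - (k - 2) = n - k" "k - (k - 2) = 2" using k assms by auto
      ultimately show ?thesis by (simp add: mult.commute)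
    next
      case False
      then show ?thesis by (simp add: binomial_eq_0)
    qed
    finally show ?thesis .
  qed
  finally show ?thesis unfolding cF .
qed

text \<open>Hockey-stick identities, obtained from Pascal's rule by induction on \<open>m\<close>;
  they sum the two parts of the closed form.\<close>

lemma sum_choose_column:
  assumes "j + 1 \<le> m"
  shows "(\<Sum>r = j + 1..m. (r - 1) choose j) = m choose (j + 1)"
    and "(\<Sum>r = j + 1..m. (r - 2) choose (j + 1)) = (m - 1) choose (j + 2)"
  using assms
proof (induction m rule: nat_induct_at_least)
  case (Suc m)
  \<comment> \<open>Makes \<open>m - 1\<close> a genuine predecessor, as Pascal's rule for the
    second sum requires.\<close>
  then obtain m' where "m = Suc m'" by (cases m) auto
  { case 1 show ?case using Suc by simp }
  { case 2 show ?case using Suc \<open>m = Suc m'\<close> by simp }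
qed (auto simp: binomial_eq_0)

theorem theorem4p6:
  fixes n :: nat
  assumes "1 \<le> n"
  shows "ne_class_count n 1 = 1 \<and>
         (\<forall>k. 2 \<le> k \<and> k \<le> n \<longrightarrow>
            ne_class_count n k =
              (\<Sum>r = k - 1..n - 1. ne_class_count r (k - 1)) + (k - 1) * ((n - 2) choose k))"
proof (intro conjI allI impI)
  show "ne_class_count n 1 = 1" using ne_class_count_closed_form[of 1 n] assms by simp
  fix k assume k: "2 \<le> k \<and> k \<le> n"
  \<comment> \<open>Substituting \<open>k = j + 2\<close> and \<open>n = Suc m\<close> removes the
    truncated subtractions.\<close>
  define j where "j = k - 2"
  define m where "m = n - 1"
  have j: "k = j + 2" and m: "n = Suc m" "j + 1 \<le> m" using k unfolding j_def m_def by auto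
  have "(\<Sum>r = k - 1..n - 1. ne_class_count r (k - 1)) =
      (\<Sum>r = j + 1..m. ((r - 1) choose j) + ((j + 1) choose 2) * ((r - 2) choose (j + 1)))"
    unfolding j m by (intro sum.cong) (auto simp: ne_class_count_closed_form)
  also have "\<dots> = (m choose (j + 1)) + ((j + 1) choose 2) * ((m - 1) choose (j + 2))"
    using sum_choose_column[OF m(2)] by (simp add: sum.distrib flip: sum_distrib_left)
  \<comment> \<open>Pascal's rule: adding \<open>k - 1 = j + 1\<close> turns the coefficient
    \<open>(j + 1) choose 2\<close> into \<open>(j + 2) choose 2\<close>.\<close>
  also have "\<dots> + (k - 1) * ((n - 2) choose k) =
      (m choose (j + 1)) + ((j + 2) choose 2) * ((m - 1) choose (j + 2))"
    unfolding j m by (simp add: numeral_2_eq_2 algebra_simps)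
  also have "\<dots> = ne_class_count n k"
    using ne_class_count_closed_form[of k n] k unfolding j m by simp
  finally show "ne_class_count n k =
      (\<Sum>r = k - 1..n - 1. ne_class_count r (k - 1)) + (k - 1) * ((n - 2) choose k)" by simp
qed

end
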